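(* Let $K\subseteq\mathbb C$ be compact and suppose that $f\in P(K)$ is injective. Let $S_\infty=\partial\widehat K$ be the outer boundary of $K$ and let $f^*$ be the Gelfand transform of $f$ on $\widehat K$. Then $f^*$ is injective on $\widehat K$ if and only if $f$ maps the outer boundary $S_\infty$ of $K$ onto the outer boundary of $f(K)$, that is, $f(S_\infty)=\partial\widehat{f(K)}$. Moreover, in that case, $f^*(\widehat K)=\widehat{f(K)}$ and each hole of $f(S_\infty)$ is the image under $f^*$ of a unique hole of $S_\infty$.
   Context: For compact $K\subseteq\mathbb C$, $P(K)$ is the uniform closure in $C(K)$ (complex-valued continuous functions on $K$) of the restrictions to $K$ of polynomials in $z$. A hole of a compact set $E\subseteq\mathbb C$ is a bounded connected component of $\mathbb C\setminus E$. The polynomial convex hull $\widehat E$ of $E$ is the union of $E$ with all its holes. The outer boundary of $E$ is $\partial\widehat E$, the topological boundary of $\widehat E$. For $f\in P(K)$, the Gelfand transform $f^*$ of $f$ is the unique continuous extension of $f$ to $\widehat K$ which is holomorphic in the interior of $\widehat K$ (equivalently: if polynomials $p_n\to f$ uniformly on $K$, then $f^*$ is the uniform limit of $(p_n)$ on $\widehat K$). *)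

theory Defs
  imports "HOL-Complex_Analysis.Complex_Analysis"
begin

definition holes :: "complex set \<Rightarrow> complex set set" where
  "holes E = {C \<in> components (- E). bounded C}"

definition poly_convex_hull :: "complex set \<Rightarrow> complex set" where
  "poly_convex_hull E = E \<union> \<Union> (holes E)"

definition outer_boundary :: "complex set \<Rightarrow> complex set" where
  "outer_boundary E = frontier (poly_convex_hull E)"

text \<open>
  The space \<open>P(K)\<close>. Elements of \<open>C(K)\<close> are represented by total functions of which only the
  values on \<open>K\<close> matter.
\<close>

definition poly_closure :: "complex set \<Rightarrow> (complex \<Rightarrow> complex) set" where
  "poly_closure K =
     {f. continuous_on K f \<and>
         (\<exists>p :: nat \<Rightarrow> complex poly. uniform_limit K (\<lambda>n. poly (p n)) f sequentially)}"

text \<open>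
  The function \<open>f\<^sup>*\<close> lives on the polynomial convex hull of \<open>K\<close>; membership in
  \<^const>\<open>extensional\<close> fixes an irrelevant value off the hull, so that the description is definite.
\<close>

definition is_gelfand_transform ::
    "complex set \<Rightarrow> (complex \<Rightarrow> complex) \<Rightarrow> (complex \<Rightarrow> complex) \<Rightarrow> bool" where
  "is_gelfand_transform K f g \<longleftrightarrow>
     g \<in> extensional (poly_convex_hull K) \<and>
     continuous_on (poly_convex_hull K) g \<and>
     g holomorphic_on interior (poly_convex_hull K) \<and>
     (\<forall>z\<in>K. g z = f z)"

definition gelfand_transform ::
    "complex set \<Rightarrow> (complex \<Rightarrow> complex) \<Rightarrow> complex \<Rightarrow> complex" where
  "gelfand_transform K f = (THE g. is_gelfand_transform K f g)"

lemma poly_convex_hull_eq: "poly_convex_hull E = - outside E"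
proof -
  have "\<Union> (holes E) = inside E"
  proof
    show "\<Union> (holes E) \<subseteq> inside E"
      unfolding holes_def inside_def components_def
      by clarsimp (metis ComplD connected_component_eq connected_component_in mem_Collect_eq)
    show "inside E \<subseteq> \<Union> (holes E)"
      unfolding holes_def inside_def components_def
      by (force simp: connected_component_refl)
  qed
  then show ?thesis
    by (simp add: poly_convex_hull_def union_with_inside)
qed

lemma compact_poly_convex_hull:
  assumes "compact K" shows "compact (poly_convex_hull K)"
proof -
  have "open (outside K)" "bounded (inside K)" "bounded K"
    using assms by (auto simp: open_outside bounded_inside compact_imp_closed compact_imp_bounded)
  then show ?thesis
    unfolding poly_convex_hull_eq compact_eq_bounded_closed
    by (metis bounded_Un closed_Compl union_with_inside)
qed

lemma outer_boundary_subset: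
  assumes "compact K" shows "outer_boundary K \<subseteq> K"
  using frontier_outside_subset[of K] assms
  by (simp add: outer_boundary_def poly_convex_hull_eq compact_imp_closed frontier_complement)

lemma poly_convex_hull_superset: "K \<subseteq> poly_convex_hull K"
  by (auto simp: poly_convex_hull_def)

lemma poly_convex_hull_norm_bound:
  assumes K: "compact K"
    and cont: "continuous_on (poly_convex_hull K) g"
    and hol: "g holomorphic_on interior (poly_convex_hull K)"
    and le: "\<And>z. z \<in> K \<Longrightarrow> norm (g z) \<le> B"
    and z: "z \<in> poly_convex_hull K"
  shows "norm (g z) \<le> B"
proof (rule maximum_modulus_frontier[OF hol _ _ _ z])
  note c = compact_poly_convex_hull[OF K]
  show "continuous_on (closure (poly_convex_hull K)) g"
    using cont c by (simp add: closure_closed compact_imp_closed)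
  show "bounded (poly_convex_hull K)"
    using c by (rule compact_imp_bounded)
  show "norm (g w) \<le> B" if "w \<in> frontier (poly_convex_hull K)" for w
    using that outer_boundary_subset[OF K] le by (auto simp: outer_boundary_def)
qed

lemma is_gelfand_transform_unique:
  assumes K: "compact K" and g: "is_gelfand_transform K f g" and h: "is_gelfand_transform K f h"
  shows "g = h"
proof (rule extensionalityI)
  show "g \<in> extensional (poly_convex_hull K)" "h \<in> extensional (poly_convex_hull K)"
    using g h by (auto simp: is_gelfand_transform_def)
  fix z assume z: "z \<in> poly_convex_hull K"
  have "norm ((\<lambda>w. g w - h w) z) \<le> 0"
    by (rule poly_convex_hull_norm_bound[OF K _ _ _ z])
       (use g h in \<open>auto simp: is_gelfand_transform_def intro!: continuous_intros holomorphic_intros\<close>)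
  then show "g z = h z" by simp
qed

lemma is_gelfand_transform_exists:
  assumes K: "compact K" and f: "f \<in> poly_closure K"
  shows "\<exists>g. is_gelfand_transform K f g"
proof -
  define H where "H = poly_convex_hull K"
  obtain p :: "nat \<Rightarrow> complex poly" where p: "uniform_limit K (\<lambda>n. poly (p n)) f sequentially"
    using f by (auto simp: poly_closure_def)
  have "uniformly_Cauchy_on K (\<lambda>n. poly (p n))"
    using p uniformly_convergent_Cauchy uniformly_convergent_on_def by blast
  then have "uniformly_Cauchy_on H (\<lambda>n. poly (p n))"
    unfolding uniformly_Cauchy_on_def
  proof (intro allI impI)
    fix e :: real assume C: "\<forall>e>0. \<exists>M. \<forall>x\<in>K. \<forall>m\<ge>M. \<forall>n\<ge>M. dist (poly (p m) x) (poly (p n) x) < e"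
      and "e > 0"
    then have "e/2 > 0" by simp
    then obtain M where M: "\<forall>x\<in>K. \<forall>m\<ge>M. \<forall>n\<ge>M. dist (poly (p m) x) (poly (p n) x) < e/2"
      using C by blast
    have "dist (poly (p m) x) (poly (p n) x) < e" if "x \<in> H" "m \<ge> M" "n \<ge> M" for x m n
    proof -
      have "norm ((\<lambda>w. poly (p m) w - poly (p n) w) x) \<le> e/2"
        by (rule poly_convex_hull_norm_bound[OF K])
           (use that M in \<open>auto simp: H_def dist_norm less_imp_le
              intro!: continuous_intros holomorphic_intros\<close>)
      then show ?thesis using \<open>e > 0\<close> by (simp add: dist_norm)
    qed
    then show "\<exists>M. \<forall>x\<in>H. \<forall>m\<ge>M. \<forall>n\<ge>M. dist (poly (p m) x) (poly (p n) x) < e"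
      by blast
  qed
  then obtain g where g: "uniform_limit H (\<lambda>n. poly (p n)) g sequentially"
    using Cauchy_uniformly_convergent uniformly_convergent_on_def by blast
  have cont: "continuous_on H g"
    by (rule uniform_limit_theorem[OF _ g]) (auto intro!: continuous_intros always_eventually)
  have hol: "g holomorphic_on interior H"
  proof (rule holomorphic_uniform_sequence[where f = "\<lambda>n. poly (p n)"])
    fix x assume "x \<in> interior H"
    then obtain d where d: "d > 0" "cball x d \<subseteq> interior H"
      using open_contains_cball[of "interior H"] by auto
    moreover have "uniform_limit (cball x d) (\<lambda>n. poly (p n)) g sequentially"
      using d interior_subset by (blast intro: uniform_limit_on_subset[OF g])
    ultimately show "\<exists>d>0. cball x d \<subseteq> interior H \<and>
        uniform_limit (cball x d) (\<lambda>n. poly (p n)) g sequentially"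
      by blast
  qed (auto intro!: holomorphic_intros)
  have eq: "g z = f z" if "z \<in> K" for z
    using tendsto_uniform_limitI[OF p that] tendsto_uniform_limitI[OF g, of z] that
      poly_convex_hull_superset[of K]
    unfolding H_def by (metis LIMSEQ_unique subsetD)
  have "is_gelfand_transform K f (restrict g H)"
    unfolding is_gelfand_transform_def H_def[symmetric]
    using cont hol eq poly_convex_hull_superset[of K] interior_subset[of H]
    by (auto simp: H_def subset_iff cong: continuous_on_cong_simp
        elim!: holomorphic_transform)
  then show ?thesis by blast
qed

lemma gelfand_transform_props:
  assumes "compact K" "f \<in> poly_closure K"
  shows "is_gelfand_transform K f (gelfand_transform K f)"
  unfolding gelfand_transform_def
  using is_gelfand_transform_exists[OF assms] is_gelfand_transform_unique[OF assms(1)]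
  by (metis theI)

end

theory Submission
  imports Defs
begin

text \<open>
  Write \<open>S\<close> for the outer boundary of \<open>K\<close> and \<open>g\<close> for \<open>f\<^sup>*\<close>.

  If \<open>g\<close> is injective on the hull, it is a homeomorphism onto its image, so by Borsuk's theorem the
  complement of the image is connected; hence the image is the hull of \<open>f(K)\<close>, and invariance of
  domain matches boundaries and holes.

  Conversely, let \<open>f\<close> map \<open>S\<close> onto the outer boundary \<open>T\<close> of \<open>f(K)\<close>, and let \<open>z\<^sub>1\<close>, \<open>z\<^sub>2\<close> be interior
  points of the hull with \<open>g(z\<^sub>1) = g(z\<^sub>2) = w\<close>. The nonvanishing function \<open>u(y) = f\<^sup>-\<^sup>1(y) - z\<^sub>1\<close> on \<open>T\<close> can
  be written as \<open>(y - w)\<^sup>c V(y)\<close>, where \<open>V\<close> extends without zeros to the hole of \<open>T\<close> containing \<open>w\<close>.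
  Pulling back by \<open>g\<close> and counting winding numbers in a hole \<open>G\<close> of \<open>S\<close> containing \<open>N > 0\<close> zeros of
  \<open>g - w\<close>, with multiplicity, gives \<open>c N = 1\<close> if \<open>z\<^sub>1\<close> is in \<open>G\<close> and \<open>c N = 0\<close> otherwise. So \<open>N = 1\<close> for the hole of
  \<open>z\<^sub>1\<close>, and no other hole of \<open>S\<close> contains a zero, which forces \<open>z\<^sub>1 = z\<^sub>2\<close>.
\<close>


section \<open>Winding numbers of nonvanishing functions\<close>

text \<open>A logarithm of \<open>\<phi>\<close> followed once around the circle changes by 2 pi i
  c. Dividing by \<open>(y - w) powi c\<close> removes this period, and the quotient has a logarithm
  on the circle itself.\<close>

lemma logarithm_on_sphere:
  fixes \<phi> :: "complex \<Rightarrow> complex"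
  assumes r: "r > 0" and cont: "continuous_on (sphere w r) \<phi>"
    and nz: "\<And>y. y \<in> sphere w r \<Longrightarrow> \<phi> y \<noteq> 0"
  obtains c :: int and h where "continuous_on (sphere w r) h"
    "\<And>y. y \<in> sphere w r \<Longrightarrow> \<phi> y = (y - w) powi c * exp (h y)"
proof -
  define \<psi> where "\<psi> \<zeta> = \<phi> (w + of_real r * \<zeta>)" for \<zeta>
  define p where "p t = \<psi> (exp (2 * of_real pi * \<i> * of_real t))" for t :: real
  have on: "w + of_real r * \<zeta> \<in> sphere w r" if "norm \<zeta> = 1" for \<zeta>
    using that r by (simp add: dist_norm norm_mult)
  have cont\<psi>: "continuous_on (sphere 0 1) \<psi>"
    unfolding \<psi>_def
    by (rule continuous_on_compose2[OF cont]) (use on in \<open>auto intro!: continuous_intros\<close>)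
  have contp: "continuous_on {0..1} p"
    unfolding p_def
    by (rule continuous_on_compose2[OF cont\<psi>]) (auto intro!: continuous_intros)
  have "p t \<noteq> 0" for t
    unfolding p_def \<psi>_def by (rule nz[OF on]) simp
  then obtain q where q: "continuous_on {0..1} q" "\<And>t. t \<in> {0..1} \<Longrightarrow> p t = exp (q t)"
    using continuous_logarithm_on_contractible[OF contp] convex_imp_contractible by blast
  have "exp (q 1) = exp (q 0)"
    using q(2)[of 0] q(2)[of 1] by (simp add: p_def)
  then obtain c :: int where c: "q 1 = q 0 + of_int (2 * c) * of_real pi * \<i>"
    by (auto simp: exp_eq)
  define q0 where "q0 t = q t - of_int (2 * c) * of_real pi * \<i> * of_real t" for t
  have contq0: "continuous_on {0..1} q0"
    unfolding q0_def by (intro continuous_intros q)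
  \<comment> \<open>With the linear term subtracted, \<open>q0\<close> is a closed loop,
    contractible in the plane. Composition with \<open>exp\<close> carries the contraction into the
    punctured plane, and an inessential map of the circle has a continuous logarithm.\<close>
  have "homotopic_loops UNIV q0 (\<lambda>t. 0)"
    using contq0 c by (intro homotopic_loops_linear)
      (auto simp: path_def pathfinish_def pathstart_def q0_def algebra_simps)
  then have "homotopic_loops (-{0}) (exp \<circ> q0) (exp \<circ> (\<lambda>t. 0))"
    by (rule homotopic_loops_continuous_image) (auto intro!: continuous_intros)
  from homotopic_loops_imp_homotopic_circlemaps[OF this]
  have "\<exists>a. homotopic_with_canon (\<lambda>h. True) (sphere 0 1) (-{0})
            (exp \<circ> q0 \<circ> (\<lambda>z. Arg2pi z / (2 * pi))) (\<lambda>t. a)"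
    by (auto simp: o_def)
  then obtain l where l: "continuous_on (sphere 0 1) l"
    and "\<forall>z\<in>sphere 0 1. (exp \<circ> q0 \<circ> (\<lambda>z. Arg2pi z / (2 * pi))) z = exp (l z)"
    unfolding inessential_eq_continuous_logarithm by blast
  then have leq: "exp (q0 (Arg2pi z / (2 * pi))) = exp (l z)" if "norm z = 1" for z
    using that by auto
  have \<psi>eq: "\<psi> z = z powi c * exp (l z)" if z: "norm z = 1" for z
  proof -
    define t where "t = Arg2pi z / (2 * pi)"
    have zt: "z = exp (2 * of_real pi * \<i> * of_real t)"
      using Arg2pi_eq[of z] z by (simp add: t_def mult_ac)
    have t: "t \<in> {0..1}"
      using Arg2pi_ge_0[of z] Arg2pi_lt_2pi[of z] by (auto simp: t_def)
    have "\<psi> z = exp (q t)" using q(2)[OF t] zt by (simp add: p_def)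
    also have "\<dots> = exp (of_int c * (2 * of_real pi * \<i> * of_real t)) * exp (q0 t)"
      unfolding exp_add[symmetric] by (simp add: q0_def algebra_simps)
    also have "exp (of_int c * (2 * of_real pi * \<i> * of_real t)) = z powi c"
      unfolding zt by (simp add: exp_power_int mult_ac)
    also have "exp (q0 t) = exp (l z)" using leq z by (simp add: t_def)
    finally show ?thesis .
  qed
  show ?thesis
  proof
    \<comment> \<open>The subtracted constant absorbs the factor r^c that appears when the unit
      circle is rescaled to radius \<open>r\<close>.\<close>
    let ?h = "\<lambda>y. l ((y - w) / of_real r) - of_int c * of_real (ln r)"
    have in1: "norm ((y - w) / of_real r) = 1" if "y \<in> sphere w r" for y
      using that r by (simp add: norm_divide dist_norm norm_minus_commute)
    show "continuous_on (sphere w r) ?h"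
      by (intro continuous_intros continuous_on_compose2[OF l])
        (use in1 r in \<open>auto simp del: norm_divide\<close>)
    show "\<phi> y = (y - w) powi c * exp (?h y)" if y: "y \<in> sphere w r" for y
    proof -
      have "\<phi> y = \<psi> ((y - w) / of_real r)" using r by (simp add: \<psi>_def)
      also have "\<dots> = ((y - w) / of_real r) powi c * exp (l ((y - w) / of_real r))"
        by (rule \<psi>eq[OF in1[OF y]])
      also have "exp (of_int c * of_real (ln r)) = (of_real r :: complex) powi c"
        using r exp_power_int[of "of_real (ln r) :: complex" c]
        by (simp add: exp_of_real)
      then have "((y - w) / of_real r) powi c = (y - w) powi c * exp (- (of_int c * of_real (ln r)))"
        by (simp add: exp_minus divide_inverse power_int_mult_distrib power_int_inverse)
      finally show ?thesis by (simp add: exp_diff exp_minus field_simps)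
    qed
  qed
qed

text \<open>\<open>F\<close> has a logarithm on the whole plane, so it has winding number 0 along
  every circle; near infinity it behaves like z^(-m), with winding number -m.\<close>

lemma nonvanishing_winding_zero:
  fixes F :: "complex \<Rightarrow> complex"
  assumes cont: "continuous_on UNIV F" and nz: "\<And>z. F z \<noteq> 0"
    and lim: "((\<lambda>z. F z * z powi m) \<longlongrightarrow> 1) at_infinity"
  shows "m = 0"
proof -
  obtain l where l: "continuous_on UNIV l" "\<And>z. F z = exp (l z)"
    using continuous_logarithm_on_contractible[OF cont contractible_UNIV] nz by auto
  have "\<forall>\<^sub>F z in at_infinity. dist (F z * z powi m) 1 < 1"
    using lim by (rule tendstoD) simp
  then obtain B where B: "\<And>z. norm z \<ge> B \<Longrightarrow> dist (F z * z powi m) 1 < 1"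
    by (auto simp: eventually_at_infinity)
  define R where "R = max B 1"
  have R: "R > 0" "R \<ge> B" by (auto simp: R_def)
  define e where "e t = exp (of_real (ln R) + 2 * of_real pi * \<i> * of_real t)" for t :: real
  have norm_e: "norm (e t) = R" for t
    using R by (simp add: e_def)
  have conte: "continuous_on X e" for X
    unfolding e_def by (intro continuous_intros)
  have e0: "e t \<noteq> 0" for t by (simp add: e_def)
  have ball: "F (e t) * e t powi m \<in> ball 1 1" for t
    using B[of "e t"] norm_e R by (simp add: dist_commute)
  have slit: "F (e t) * e t powi m \<notin> \<real>\<^sub>\<le>\<^sub>0" for t
    using ball[of t] by (auto simp: complex_nonpos_Reals_iff dist_norm dest!: complex_Re_le_cmod[THEN order.strict_trans1])
  \<comment> \<open>\<open>p\<close> and \<open>q\<close> are two logarithms of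
    \<open>F (e t) * e t powi m\<close> along the large circle. \<open>p\<close> gains 2 pi i m,
    whereas \<open>q\<close> closes up, since the values stay in a disc on which \<open>Ln\<close>
    is continuous.\<close>
  define p where "p t = l (e t) + of_int m * (of_real (ln R) + 2 * of_real pi * \<i> * of_real t)"
    for t :: real
  define q where "q t = Ln (F (e t) * e t powi m)" for t :: real
  have "path p"
    unfolding path_def p_def
    by (intro continuous_intros continuous_on_compose2[OF l(1)] conte) auto
  moreover have "path q"
    unfolding path_def q_def
    by (intro continuous_intros continuous_on_compose2[OF cont] conte slit) (use e0 in auto)
  moreover have "(exp \<circ> p) t = (exp \<circ> q) t" for t
  proof -
    have "exp (q t) = F (e t) * e t powi m" using nz e0 by (simp add: q_def)
    also have "e t powi m = exp (of_int m * (of_real (ln R) + 2 * of_real pi * \<i> * of_real t))"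
      by (simp add: e_def exp_power_int)
    finally show ?thesis by (simp add: p_def exp_add l(2))
  qed
  \<comment> \<open>Winding numbers turn equality of the exponentials into equality of the
    increments of \<open>p\<close> and \<open>q\<close>.\<close>
  then have "winding_number (exp \<circ> p) 0 = winding_number (exp \<circ> q) 0"
    by (intro winding_number_cong)
  ultimately have "pathfinish p - pathstart p = pathfinish q - pathstart q"
    using winding_number_compose_exp by simp
  moreover have "e 1 = e 0" by (simp add: e_def exp_add)
  ultimately show ?thesis
    by (simp add: pathfinish_def pathstart_def p_def q_def algebra_simps)
qed

lemma prod_list_tendsto:
  "((\<lambda>z. (\<Prod>a\<leftarrow>as. z - a) / z ^ length as) \<longlongrightarrow> (1::complex)) at_infinity"
proof (induction as)
  case (Cons a as)
  have "((\<lambda>z. 1 - a / z) \<longlongrightarrow> 1 - 0) at_infinity"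
    by (intro tendsto_intros tendsto_divide_0[OF tendsto_const] filterlim_ident)
  then have "((\<lambda>z. (1 - a / z) * ((\<Prod>a\<leftarrow>as. z - a) / z ^ length as)) \<longlongrightarrow> 1 * 1) at_infinity"
    by (intro tendsto_mult Cons) simp
  moreover have "\<forall>\<^sub>F z in at_infinity. (1 - a / z) * ((\<Prod>a\<leftarrow>as. z - a) / z ^ length as)
      = (\<Prod>a\<leftarrow>a # as. z - a) / z ^ length (a # as)"
    using eventually_not_equal_at_infinity[of 0] by eventually_elim (simp add: field_simps)
  ultimately show ?case by (simp add: tendsto_cong)
qed simp


lemma tendsto_powi_1:
  fixes f :: "'a \<Rightarrow> complex"
  assumes "(f \<longlongrightarrow> 1) F" shows "((\<lambda>z. f z powi c) \<longlongrightarrow> 1) F"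
  using tendsto_power_int[OF assms, of c] by simp

text \<open>Gluing \<open>E\<close> on the hole \<open>G\<close> to \<open>R\<close> off \<open>G\<close> gives a function without zeros on the whole plane.\<close>

lemma nonvanishing_glue_winding_zero:
  fixes E R :: "complex \<Rightarrow> complex"
  assumes S: "closed S" and G: "G \<in> components (- S)" "bounded G"
    and E: "continuous_on (S \<union> G) E" "\<And>z. z \<in> S \<union> G \<Longrightarrow> E z \<noteq> 0"
    and R: "continuous_on (- G) R" "\<And>z. z \<notin> G \<Longrightarrow> R z \<noteq> 0"
    and eq: "\<And>z. z \<in> S \<Longrightarrow> E z = R z"
    and lim: "((\<lambda>z. R z * z powi m) \<longlongrightarrow> 1) at_infinity"
  shows "m = 0"
proof (rule nonvanishing_winding_zero)
  let ?F = "\<lambda>z. if z \<in> G then E z else R z"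
  have "open G" using G S open_components by blast
  have "closed (S \<union> G)"
    using closed_Un_complement_component[OF S G(1)] by (simp add: Un_commute)
  \<comment> \<open>The two closed pieces overlap exactly in \<open>S\<close>, where
    \<open>E\<close> and \<open>R\<close> agree.\<close>
  have "continuous_on ((S \<union> G) \<union> (- G)) ?F"
    using \<open>open G\<close> \<open>closed (S \<union> G)\<close> E R eq by (intro continuous_on_cases) auto
  moreover have "(S \<union> G) \<union> (- G) = UNIV" by auto
  ultimately show "continuous_on UNIV ?F" by simp
  show "?F z \<noteq> 0" for z using E R by auto
  obtain B where "\<And>z. z \<in> G \<Longrightarrow> norm z \<le> B" using G bounded_iff by blast
  then have "\<forall>\<^sub>F z in at_infinity. R z * z powi m = ?F z * z powi m"
    by (force simp: eventually_at_infinity intro: exI[of _ "B + 1"])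
  with lim show "((\<lambda>z. ?F z * z powi m) \<longlongrightarrow> 1) at_infinity"
    by (rule Lim_transform_eventually)
qed

lemma powi_minus_divide_power:
  fixes q z :: complex
  assumes "z \<noteq> 0"
  shows "(q / z ^ n) powi - c = q powi - c * z powi (c * int n)"
proof -
  have "(q / z ^ n) powi - c = q powi - c / (z ^ n) powi - c"
    by (rule power_int_divide_distrib)
  also have "(z ^ n) powi - c = inverse (z powi (c * int n))"
    by (simp add: power_int_power power_int_minus mult.commute)
  finally show ?thesis by (simp add: divide_inverse)
qed

section \<open>Degree over a hole, and extension into a hole\<close>

text \<open>Put N = \<open>length as\<close>. Rearranging \<open>eq\<close> so that one side has no
  zeros on \<open>S \<union> G\<close> and the other none off \<open>G\<close> yields a glued
  nonvanishing function on the plane, asymptotic to z^(1 - c N) or z^(- c N) according to the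
  position of \<open>a\<close>. The exponent must vanish.\<close>

lemma degree_over_component:
  fixes E :: "complex \<Rightarrow> complex"
  assumes S: "closed S" and G: "G \<in> components (- S)" "bounded G"
    and E: "continuous_on (S \<union> G) E" "\<And>z. z \<in> S \<union> G \<Longrightarrow> E z \<noteq> 0"
    and as: "set as \<subseteq> G" and a: "a \<notin> S"
    and eq: "\<And>z. z \<in> S \<Longrightarrow> z - a = (\<Prod>b\<leftarrow>as. z - b) powi c * E z"
  shows "c * int (length as) = (if a \<in> G then 1 else 0)"
proof -
  define Q where "Q z = (\<Prod>b\<leftarrow>as. z - b)" for z
  have contQ: "continuous_on X Q" for X
    unfolding Q_def by (induction as) (auto intro!: continuous_intros)
  have Q0: "Q z \<noteq> 0" if "z \<notin> G" for z
    using as that unfolding Q_def by (induction as) auto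
  have GS: "G \<inter> S = {}" using in_components_subset[OF G(1)] by auto
  have limQ: "((\<lambda>z. (Q z / z ^ length as) powi - c) \<longlongrightarrow> 1) at_infinity"
    unfolding Q_def by (rule tendsto_powi_1[OF prod_list_tendsto])
  show ?thesis
  proof (cases "a \<in> G")
    case True
    \<comment> \<open>The zero of \<open>z - a\<close> lies in \<open>G\<close>, so this factor
      belongs to the outer piece.\<close>
    have "((\<lambda>z. ((z - a) / z) * (Q z / z ^ length as) powi - c) \<longlongrightarrow> 1 * 1) at_infinity"
      using prod_list_tendsto[of "[a]"] by (intro tendsto_mult limQ) simp
    moreover have "\<forall>\<^sub>F z in at_infinity. ((z - a) / z) * (Q z / z ^ length as) powi - c
        = (z - a) * Q z powi - c * z powi (c * int (length as) - 1)"
      using eventually_not_equal_at_infinity[of 0]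
    proof eventually_elim
      case (elim z)
      then have "z powi (c * int (length as) - 1) = z powi (c * int (length as)) / z"
        by (simp add: power_int_diff)
      then show ?case
        unfolding powi_minus_divide_power[OF elim] by simp
    qed
    ultimately have lim: "((\<lambda>z. (z - a) * Q z powi - c * z powi (c * int (length as) - 1)) \<longlongrightarrow> 1) at_infinity"
      by (simp add: tendsto_cong)
    have "c * int (length as) - 1 = 0"
    proof (rule nonvanishing_glue_winding_zero[OF S G E _ _ _ lim])
      show "continuous_on (- G) (\<lambda>z. (z - a) * Q z powi - c)"
        by (intro continuous_intros contQ) (use Q0 in auto)
      show "(z - a) * Q z powi - c \<noteq> 0" if "z \<notin> G" for z
        using that True Q0 by auto
      show "E z = (z - a) * Q z powi - c" if "z \<in> S" for z
      proof -
        have "Q z powi c \<noteq> 0" using Q0[of z] that GS by auto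
        then show ?thesis using eq[OF that] by (simp add: Q_def power_int_minus)
      qed
    qed auto
    then show ?thesis using True by simp
  next
    case False
    \<comment> \<open>The zero of \<open>z - a\<close> lies off \<open>S \<union> G\<close>, so this
      factor is divided into the inner piece \<open>E z / (z - a)\<close>.\<close>
    have "\<forall>\<^sub>F z in at_infinity. (Q z / z ^ length as) powi - c
        = Q z powi - c * z powi (c * int (length as))"
      using eventually_not_equal_at_infinity[of 0]
      by eventually_elim (rule powi_minus_divide_power)
    with limQ have lim: "((\<lambda>z. Q z powi - c * z powi (c * int (length as))) \<longlongrightarrow> 1) at_infinity"
      by (simp add: tendsto_cong)
    have "c * int (length as) = 0"
    proof (rule nonvanishing_glue_winding_zero[OF S G _ _ _ _ _ lim])
      show "continuous_on (S \<union> G) (\<lambda>z. E z / (z - a))"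
        by (intro continuous_intros E) (use a False in auto)
      show "E z / (z - a) \<noteq> 0" if "z \<in> S \<union> G" for z
        using E(2) that a False by auto
      show "continuous_on (- G) (\<lambda>z. Q z powi - c)"
        by (intro continuous_intros contQ) (use Q0 in auto)
      show "Q z powi - c \<noteq> 0" if "z \<notin> G" for z
        using that Q0 by auto
      show "E z / (z - a) = Q z powi - c" if "z \<in> S" for z
      proof -
        have "Q z powi c \<noteq> 0" "E z \<noteq> 0" using Q0[of z] E(2)[of z] that GS by auto
        then show ?thesis using eq[OF that] by (simp add: Q_def power_int_minus divide_simps)
      qed
    qed
    then show ?thesis using False by simp
  qed
qed

text \<open>The circle-valued \<open>sgn (u y)\<close> extends to the plane up to finitely many
  punctures, of which only \<open>w\<close> can lie in \<open>T \<union> W\<close>. The winding at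
  that puncture is \<open>c\<close>; once it is divided out, the puncture can be filled without
  creating a zero.\<close>

lemma extend_over_component:
  fixes u :: "complex \<Rightarrow> complex"
  assumes T: "compact T" and W: "W \<in> components (- T)" "w \<in> W"
    and u: "continuous_on T u" "\<And>y. y \<in> T \<Longrightarrow> u y \<noteq> 0"
  obtains c :: int and V where "continuous_on (T \<union> W) V" "\<And>y. y \<in> T \<union> W \<Longrightarrow> V y \<noteq> 0"
    "\<And>y. y \<in> T \<Longrightarrow> u y = (y - w) powi c * V y"
proof -
  have WT: "W \<inter> T = {}" using in_components_subset[OF W(1)] by auto
  have "open W" using W T open_components compact_imp_closed by blast
  have "continuous_on T (\<lambda>y. sgn (u y))" "(\<lambda>y. sgn (u y)) \<in> T \<rightarrow> sphere 0 1"
    using u by (auto intro!: continuous_intros simp: norm_sgn)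
  \<comment> \<open>Every component other than \<open>W\<close> lies in \<open>- W\<close>, and
    \<open>W\<close> contains \<open>w\<close>, so each component offers an admissible place for a
    puncture.\<close>
  moreover have "C \<inter> (insert w (- W)) \<noteq> {}" if "C \<in> components (- T)" for C
    using components_nonoverlap[OF that W(1)] in_components_nonempty[OF that] W(2) by fastforce
  ultimately obtain F v where F: "F \<subseteq> insert w (- W)" "disjnt F T"
    and v: "continuous_on (- F) v" "v \<in> - F \<rightarrow> sphere 0 1" "\<And>y. y \<in> T \<Longrightarrow> v y = sgn (u y)"
    using extend_map_UNIV_to_sphere_cofinite[of 1 T "\<lambda>y. sgn (u y)" 0 "insert w (- W)"] T
    by (metis order_refl zero_le_one)
  have v0: "v y \<noteq> 0" if "y \<in> T \<union> W" "y \<noteq> w" for y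
  proof -
    have "y \<in> - F" using that F by (auto simp: disjnt_def)
    then have "norm (v y) = 1" using v(2) by (auto simp: Pi_iff)
    then show ?thesis by auto
  qed
  have contv: "continuous_on X v" if "X \<subseteq> T \<union> W - {w}" for X
    by (rule continuous_on_subset[OF v(1)]) (use that F in \<open>auto simp: disjnt_def\<close>)
  obtain r where r: "r > 0" "cball w r \<subseteq> W"
    using \<open>open W\<close> W(2) open_contains_cball by blast
  have sph: "sphere w r \<subseteq> T \<union> W - {w}" using r by (auto simp: subset_iff)
  have vsph: "v y \<noteq> 0" if "y \<in> sphere w r" for y
    using v0 subsetD[OF sph that] by auto
  obtain c :: int and h where h: "continuous_on (sphere w r) h"
    "\<And>y. y \<in> sphere w r \<Longrightarrow> v y = (y - w) powi c * exp (h y)"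
    by (rule logarithm_on_sphere[OF r(1) contv[OF sph] vsph]) (assumption, rule that)
  \<comment> \<open>Extending the logarithm, rather than the function, keeps the filled-in values
    nonzero.\<close>
  obtain h' where h': "continuous_on UNIV h'" "\<And>y. y \<in> sphere w r \<Longrightarrow> h' y = h y"
    using Tietze_unbounded[OF h(1), of UNIV] by auto
  \<comment> \<open>\<open>sgn\<close> has kept only the argument of \<open>u\<close>; the modulus
    is restored by the positive factor \<open>exp (\<rho> y)\<close>.\<close>
  have "continuous_on T (\<lambda>y. ln (norm (u y)))" using u by (intro continuous_intros) auto
  then obtain \<rho> :: "complex \<Rightarrow> real" where
    \<rho>: "continuous_on UNIV \<rho>" "\<And>y. y \<in> T \<Longrightarrow> \<rho> y = ln (norm (u y))"
    using Tietze_unbounded[of T "\<lambda>y. ln (norm (u y))" UNIV] T compact_imp_closed by auto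
  let ?V = "\<lambda>y. if y \<in> cball w r then exp (h' y) else v y / (y - w) powi c"
  have "continuous_on (cball w r \<union> (T \<union> W - ball w r)) ?V"
  proof (rule continuous_on_cases_local)
    show "continuous_on (cball w r) (\<lambda>y. exp (h' y))"
      by (intro continuous_intros continuous_on_subset[OF h'(1)]) auto
    show "continuous_on (T \<union> W - ball w r) (\<lambda>y. v y / (y - w) powi c)"
      by (intro continuous_intros contv) (use r in auto)
    show "closedin (top_of_set (cball w r \<union> (T \<union> W - ball w r))) (cball w r)"
      by (intro closed_subset) auto
    have "T \<union> W - ball w r = (cball w r \<union> (T \<union> W - ball w r)) \<inter> - ball w r"
      using r by auto
    then show "closedin (top_of_set (cball w r \<union> (T \<union> W - ball w r))) (T \<union> W - ball w r)"
      by (metis closed_Compl closedin_closed_Int open_ball)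
    show "exp (h' y) = v y / (y - w) powi c"
      if "y \<in> cball w r \<and> y \<notin> cball w r \<or> y \<in> T \<union> W - ball w r \<and> y \<in> cball w r" for y
    proof -
      have "y \<in> sphere w r" using that by auto
      moreover from this have "y \<noteq> w" using r by auto
      ultimately show ?thesis using h(2)[of y] h'(2)[of y] by simp
    qed
  qed
  moreover have "cball w r \<union> (T \<union> W - ball w r) = T \<union> W" using r by auto
  ultimately have contV: "continuous_on (T \<union> W) ?V" by simp
  show ?thesis
  proof
    show "continuous_on (T \<union> W) (\<lambda>y. ?V y * of_real (exp (\<rho> y)))"
      by (intro continuous_on_mult contV continuous_intros continuous_on_subset[OF \<rho>(1)]) auto
    show "?V y * of_real (exp (\<rho> y)) \<noteq> 0" if "y \<in> T \<union> W" for y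
      using v0[OF that] r(1) by (cases "y = w") auto
    show "u y = (y - w) powi c * (?V y * of_real (exp (\<rho> y)))" if y: "y \<in> T" for y
    proof -
      have "y \<notin> cball w r" "y \<noteq> w" using y r WT W by auto
      then show ?thesis using v(3)[OF y] \<rho>(2)[OF y] u(2)[OF y] by (simp add: sgn_eq)
    qed
  qed
qed


section \<open>Zeros and nonconstancy on holes\<close>

text \<open>Induction on the number of distinct zeros, each removed with its full multiplicity.
  Keeping \<open>X\<close> apart from \<open>U\<close> makes the cofactor continuous and
  nonvanishing up to the boundary, as needed for \<open>X = S \<union> G\<close> and
  \<open>U = G\<close>.\<close>

lemma factor_out_zeros:
  fixes h :: "complex \<Rightarrow> complex"
  assumes U: "open U" "connected U" "U \<subseteq> X"
    and h: "continuous_on X h" "h holomorphic_on U" "\<exists>z\<in>U. h z \<noteq> 0"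
    and zeros: "finite {z \<in> X. h z = 0}" "{z \<in> X. h z = 0} \<subseteq> U"
  shows "\<exists>as k. continuous_on X k \<and> (\<forall>z\<in>X. k z \<noteq> 0) \<and>
           (\<forall>z\<in>X. h z = (\<Prod>a\<leftarrow>as. z - a) * k z) \<and> set as = {z \<in> X. h z = 0}"
  using h zeros
proof (induction "card {z \<in> X. h z = 0}" arbitrary: h)
  case 0
  then have "\<forall>z\<in>X. h z \<noteq> 0" by auto
  then show ?case using 0 by (intro exI[of _ "[]"] exI[of _ h]) auto
next
  case (Suc m)
  then have "{z \<in> X. h z = 0} \<noteq> {}" by (metis card.empty nat.distinct(1))
  then obtain \<xi> where \<xi>: "\<xi> \<in> X" "h \<xi> = 0" "\<xi> \<in> U" using Suc.prems(5) by auto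
  have "\<not> h constant_on U"
    using Suc.prems(3) \<xi> by (metis constant_on_def)
  then obtain g r n where r: "0 < n" "0 < r" "ball \<xi> r \<subseteq> U" "g holomorphic_on ball \<xi> r"
    and g: "\<And>w. w \<in> ball \<xi> r \<Longrightarrow> h w = (w - \<xi>) ^ n * g w" "\<And>w. w \<in> ball \<xi> r \<Longrightarrow> g w \<noteq> 0"
    using holomorphic_factor_zero_nonconstant[OF Suc.prems(2) U(1,2) \<xi>(3,2)] by metis
  \<comment> \<open>The value \<open>g \<xi>\<close> fills the removable singularity of the
    quotient.\<close>
  define k where "k z = (if z = \<xi> then g \<xi> else h z / (z - \<xi>) ^ n)" for z
  have kg: "k z = g z" if "z \<in> ball \<xi> r" for z
    using g(1)[OF that] by (simp add: k_def)
  have hk: "h z = (z - \<xi>) ^ n * k z" for z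
    using \<xi> r(1) by (simp add: k_def)
  have contk: "continuous_on X k"
    unfolding continuous_on_eq_continuous_within
  proof
    fix z assume z: "z \<in> X"
    show "continuous (at z within X) k"
    proof (cases "z = \<xi>")
      case True
      have "isCont g \<xi>"
        using r holomorphic_on_imp_continuous_on continuous_on_interior
        by (metis centre_in_ball interior_ball)
      moreover have "\<forall>\<^sub>F y in nhds \<xi>. g y = k y"
        using eventually_nhds_in_open[OF open_ball, of \<xi> \<xi> r] r(2)
        by (auto elim!: eventually_mono simp: kg)
      ultimately have "isCont k \<xi>" using isCont_cong by blast
      then show ?thesis using True continuous_at_imp_continuous_at_within by blast
    next
      case False
      have "continuous (at z within X) (\<lambda>z. h z / (z - \<xi>) ^ n)"
        using Suc.prems(1) z False by (intro continuous_intros) (auto simp: continuous_on_eq_continuous_within)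
      moreover have "\<forall>\<^sub>F y in at z within X. h y / (y - \<xi>) ^ n = k y"
        using eventually_neq_at_within[of \<xi> z X] by eventually_elim (simp add: k_def)
      ultimately have "(k \<longlongrightarrow> h z / (z - \<xi>) ^ n) (at z within X)"
        unfolding continuous_within by (rule Lim_transform_eventually)
      moreover have "k z = h z / (z - \<xi>) ^ n" using False by (simp add: k_def)
      ultimately show ?thesis by (simp add: continuous_within)
    qed
  qed
  have "k holomorphic_on U - {\<xi>}"
    by (rule holomorphic_transform[of "\<lambda>z. h z / (z - \<xi>) ^ n"])
      (auto intro!: holomorphic_intros holomorphic_on_subset[OF Suc.prems(2)] simp: k_def)
  moreover have "k holomorphic_on ball \<xi> r"
    using r kg by (auto intro: holomorphic_transform)
  ultimately have "k holomorphic_on (U - {\<xi>}) \<union> ball \<xi> r"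
    using U(1) by (intro holomorphic_on_Un) auto
  moreover have "(U - {\<xi>}) \<union> ball \<xi> r = U" using r \<xi> by auto
  ultimately have holk: "k holomorphic_on U" by simp
  have "k \<xi> \<noteq> 0" using g(2) r by (simp add: k_def)
  then have Z: "{z \<in> X. k z = 0} = {z \<in> X. h z = 0} - {\<xi>}"
    using hk by auto
  have "m = card {z \<in> X. k z = 0}"
    using Suc.hyps(2) Suc.prems(4) \<xi> unfolding Z by simp
  moreover have "\<exists>z\<in>U. k z \<noteq> 0" using \<open>k \<xi> \<noteq> 0\<close> \<xi> by blast
  moreover have "finite {z \<in> X. k z = 0}" "{z \<in> X. k z = 0} \<subseteq> U"
    using Suc.prems Z by auto
  ultimately obtain as k' where k': "continuous_on X k'" "\<forall>z\<in>X. k' z \<noteq> 0"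
    "\<forall>z\<in>X. k z = (\<Prod>a\<leftarrow>as. z - a) * k' z" "set as = {z \<in> X. k z = 0}"
    using Suc.hyps(1)[OF _ contk holk] by blast
  show ?case
  proof (intro exI conjI)
    \<comment> \<open>Repeating \<open>\<xi>\<close> in the list records its multiplicity.\<close>
    show "\<forall>z\<in>X. h z = (\<Prod>a\<leftarrow>replicate n \<xi> @ as. z - a) * k' z"
      using k'(3) hk by (simp add: prod_list_replicate map_replicate_const mult.assoc)
    show "set (replicate n \<xi> @ as) = {z \<in> X. h z = 0}"
      using k'(4) Z \<xi> r(1) by auto
  qed (use k' in auto)
qed

text \<open>In dimension at least 2 the complement of \<open>p\<close> is connected. If it missed
  the frontier, \<open>G\<close> would either be the single point \<open>p\<close>, hence not open,
  or contain all other points, hence be unbounded.\<close>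

lemma frontier_bounded_open_not_singleton:
  fixes G :: "'a::euclidean_space set"
  assumes "open G" "bounded G" "G \<noteq> {}" "2 \<le> DIM('a)"
  shows "\<not> frontier G \<subseteq> {p}"
proof
  assume fr: "frontier G \<subseteq> {p}"
  have "connected (- {p})" using assms(4) by (intro connected_punctured_universe)
  moreover have "- {p} \<inter> frontier G = {}" using fr by auto
  ultimately consider "- {p} \<inter> G = {}" | "- {p} \<subseteq> G"
    using connected_Int_frontier[of "- {p}" G] by blast
  then show False
  proof cases
    case 1
    then have "G = {p}" using assms(3) by auto
    then show False using assms(1) not_open_singleton by metis
  next
    case 2
    then have "UNIV \<subseteq> insert p G" by auto
    moreover have "bounded (insert p G)" using assms(2) by simp
    ultimately show False using bounded_subset not_bounded_UNIV by blast
  qed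
qed

text \<open>Constancy would pass to the frontier of \<open>G\<close>, which lies in
  \<open>S\<close>; injectivity there would shrink the frontier to at most one point.\<close>

lemma nonconstant_on_component:
  fixes g :: "complex \<Rightarrow> complex"
  assumes S: "closed S" and G: "G \<in> components (- S)" "bounded G"
    and g: "continuous_on (S \<union> G) g" "inj_on g S"
  shows "\<not> g constant_on G"
proof
  assume "g constant_on G"
  then obtain y where y: "\<And>z. z \<in> G \<Longrightarrow> g z = y" by (auto simp: constant_on_def)
  have fr: "frontier G \<subseteq> S" using frontier_of_components_closed_complement S G by blast
  have clo: "closure G \<subseteq> S \<union> G" using fr closure_Un_frontier[of G] by auto
  have "g z = y" if "z \<in> closure G" for z
    using continuous_constant_on_closure[OF continuous_on_subset[OF g(1) clo] y that] .
  then have "\<forall>z\<in>frontier G. \<forall>z'\<in>frontier G. z = z'"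
    using g(2) fr by (auto simp: inj_on_def frontier_def subset_iff)
  then obtain p where "frontier G \<subseteq> {p}" by blast
  moreover have "open G" "G \<noteq> {}"
    using G S open_components in_components_nonempty by blast+
  ultimately show False
    using frontier_bounded_open_not_singleton[of G p] G(2) by auto
qed


lemma hole_of_inside:
  assumes "z \<in> inside S"
  shows "connected_component_set (- S) z \<in> components (- S)"
    "bounded (connected_component_set (- S) z)" "z \<in> connected_component_set (- S) z"
    "connected_component_set (- S) z \<subseteq> inside S"
  using assms inside_same_component[of S] by (auto simp: inside_def components_def)

text \<open>\<open>inside S\<close> may be disconnected, so the open mapping theorem is applied hole
  by hole.\<close>

lemma open_image_inside:
  fixes g :: "complex \<Rightarrow> complex"
  assumes S: "closed S" and g: "continuous_on (S \<union> inside S) g" "g holomorphic_on inside S" "inj_on g S"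
  shows "open (g ` inside S)"
proof -
  have "open (g ` connected_component_set (- S) z)" if z: "z \<in> inside S" for z
  proof -
    let ?G = "connected_component_set (- S) z"
    note G = hole_of_inside[OF z]
    show ?thesis
    proof (rule open_mapping_thm)
      show "g holomorphic_on ?G" using g(2) G(4) holomorphic_on_subset by blast
      show "\<not> g constant_on ?G"
        using G g by (intro nonconstant_on_component[OF S G(1,2)]) (auto elim!: continuous_on_subset)
      show "open ?G" "open ?G" using S by (auto intro: open_connected_component)
    qed auto
  qed
  moreover have "g ` inside S = (\<Union>z\<in>inside S. g ` connected_component_set (- S) z)"
    using hole_of_inside(3,4) by blast
  ultimately show ?thesis by auto
qed

text \<open>As \<open>g\<close> avoids \<open>w\<close> on \<open>S\<close>, the zeros of
  \<open>g - w\<close> form a compact subset of \<open>G\<close>, which is finite because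
  \<open>g\<close> is not constant on \<open>G\<close>.\<close>

lemma factor_over_hole:
  fixes g :: "complex \<Rightarrow> complex"
  assumes S: "compact S" and G: "G \<in> components (- S)" "bounded G"
    and g: "continuous_on (S \<union> G) g" "g holomorphic_on G" "inj_on g S" and w: "w \<notin> g ` S"
  obtains as k where "set as = {z \<in> G. g z = w}" "continuous_on (S \<union> G) k"
    "\<And>z. z \<in> S \<union> G \<Longrightarrow> k z \<noteq> 0" "\<And>z. z \<in> S \<union> G \<Longrightarrow> g z - w = (\<Prod>a\<leftarrow>as. z - a) * k z"
proof -
  have clS: "closed S" using S by (rule compact_imp_closed)
  have oG: "open G" "connected G"
    using G clS open_components in_components_connected by blast+
  have cSG: "compact (S \<union> G)"
    using closed_Un_complement_component[OF clS G(1)] S G(2)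
    by (simp add: compact_eq_bounded_closed compact_imp_bounded Un_commute)
  define Z where "Z = {z \<in> S \<union> G. g z - w = 0}"
  have ZG: "Z \<subseteq> G" using w by (auto simp: Z_def)
  have "compact Z"
  proof -
    have "closedin (top_of_set (S \<union> G)) {z \<in> S \<union> G. g z - w = 0}"
      by (intro continuous_closedin_preimage_constant continuous_intros g)
    then show ?thesis using cSG closedin_compact unfolding Z_def by blast
  qed
  have hol: "(\<lambda>z. g z - w) holomorphic_on G" by (intro holomorphic_intros g)
  have nc: "\<not> (\<lambda>z. g z - w) constant_on G"
    using nonconstant_on_component[OF clS G g(1,3)] unfolding constant_on_def
    by (metis diff_add_cancel)
  have "finite {z \<in> Z. g z - w = 0}"
    by (rule holomorphic_compact_finite_zeros[OF hol oG \<open>compact Z\<close> ZG nc])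
  then have fin: "finite {z \<in> S \<union> G. g z - w = 0}" by (simp add: Z_def)
  have ex: "\<exists>z\<in>G. g z - w \<noteq> 0" using nc unfolding constant_on_def by blast
  have cont: "continuous_on (S \<union> G) (\<lambda>z. g z - w)" by (intro continuous_intros g)
  obtain as k where k: "continuous_on (S \<union> G) k" "\<forall>z\<in>S \<union> G. k z \<noteq> 0"
      "\<forall>z\<in>S \<union> G. g z - w = (\<Prod>a\<leftarrow>as. z - a) * k z"
      "set as = {z \<in> S \<union> G. g z - w = 0}"
    using factor_out_zeros[OF oG _ cont hol ex fin] ZG unfolding Z_def by blast
  moreover have "set as = {z \<in> G. g z = w}" using k(4) ZG by (auto simp: Z_def)
  ultimately show ?thesis using that by blast
qed

section \<open>Injectivity on the inside from injectivity on the boundary\<close>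

text \<open>The inclusion \<open>sub\<close> is the form in which the equality of outer boundaries
  is used.\<close>

lemma inj_on_inside:
  fixes g :: "complex \<Rightarrow> complex"
  assumes S: "compact S" and g: "continuous_on (S \<union> inside S) g" "g holomorphic_on inside S"
    and inj: "inj_on g S" and sub: "g ` inside S \<subseteq> inside (g ` S)"
  shows "inj_on g (S \<union> inside S)"
proof -
  define T where "T = g ` S"
  have contS: "continuous_on S g" using g(1) by (rule continuous_on_subset) auto
  have T: "compact T" unfolding T_def by (rule compact_continuous_image[OF contS S])
  have clS: "closed S" using S by (rule compact_imp_closed)
  obtain f' where f': "homeomorphism S T g f'"
    using homeomorphism_compact[OF S contS T_def[symmetric] inj] by blast
  have inside: "z1 = z2" if z: "z1 \<in> inside S" "z2 \<in> inside S" "g z1 = g z2" for z1 z2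
  proof (rule ccontr)
    assume ne: "z1 \<noteq> z2"
    define w where "w = g z1"
    define W where "W = connected_component_set (- T) w"
    have w: "w \<in> inside T" using sub z by (auto simp: w_def T_def)
    then have wT: "w \<notin> T" by (metis inside_no_overlap disjoint_iff)
    have z1S: "z1 \<notin> S" using z(1) by (metis inside_no_overlap disjoint_iff)
    have u: "continuous_on T (\<lambda>y. f' y - z1)"
      using f' by (auto simp: homeomorphism_def intro!: continuous_intros)
    have u0: "f' y - z1 \<noteq> 0" if "y \<in> T" for y
      using f' z1S that by (auto simp: homeomorphism_def)
    \<comment> \<open>\<open>c\<close> depends on \<open>z1\<close> and \<open>w\<close> but on no
      hole of \<open>S\<close>, so counts in different holes can be compared.\<close>
    obtain c :: int and V where V: "continuous_on (T \<union> W) V" "\<And>y. y \<in> T \<union> W \<Longrightarrow> V y \<noteq> 0"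
      "\<And>y. y \<in> T \<Longrightarrow> f' y - z1 = (y - w) powi c * V y"
      by (rule extend_over_component[OF T hole_of_inside(1,3)[OF w, folded W_def] u u0])
        (assumption, rule that)
    have degree: "\<exists>as. set as = {u \<in> connected_component_set (- S) z. g u = w} \<and>
        c * int (length as) = (if z1 \<in> connected_component_set (- S) z then 1 else 0)"
      if zi: "z \<in> inside S" and zw: "g z = w" for z
    proof -
      define G where "G = connected_component_set (- S) z"
      note G = hole_of_inside[OF zi, folded G_def]
      have contSG: "continuous_on (S \<union> G) g"
        using g(1) by (rule continuous_on_subset) (use G in auto)
      have holG: "g holomorphic_on G" using g(2) G(4) by (rule holomorphic_on_subset)
      \<comment> \<open>A connected image that avoids \<open>T\<close> and meets \<open>W\<close>
        stays in \<open>W\<close>; hence \<open>V (g u)\<close> makes sense on all of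
        \<open>S \<union> G\<close>.\<close>
      have "g ` G \<subseteq> - T"
        using G(4) sub inside_no_overlap[of T] unfolding T_def by blast
      moreover have "connected (g ` G)"
        unfolding G_def
        by (intro connected_continuous_image continuous_on_subset[OF contSG]) (auto simp: G_def)
      moreover have "w \<in> g ` G" using G(3) zw by auto
      ultimately have "g ` G \<subseteq> W"
        unfolding W_def by (intro connected_component_maximal)
      then have img: "g ` (S \<union> G) \<subseteq> T \<union> W" by (auto simp: T_def)
      obtain as k where as: "set as = {u \<in> G. g u = w}"
        and k: "continuous_on (S \<union> G) k" "\<And>u. u \<in> S \<union> G \<Longrightarrow> k u \<noteq> 0"
          "\<And>u. u \<in> S \<union> G \<Longrightarrow> g u - w = (\<Prod>a\<leftarrow>as. u - a) * k u"
        by (rule factor_over_hole[OF S G(1,2) contSG holG inj wT[unfolded T_def]]) (rule that; assumption)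
      have "c * int (length as) = (if z1 \<in> G then 1 else 0)"
      proof (rule degree_over_component[OF clS G(1,2)])
        show "continuous_on (S \<union> G) (\<lambda>u. k u powi c * V (g u))"
          by (intro continuous_intros k continuous_on_compose2[OF V(1) contSG]) (use img k(2) in auto)
        show "k u powi c * V (g u) \<noteq> 0" if "u \<in> S \<union> G" for u
          using k(2) V(2) img that by auto
        show "u - z1 = (\<Prod>b\<leftarrow>as. u - b) powi c * (k u powi c * V (g u))" if u: "u \<in> S" for u
        proof -
          have "u - z1 = f' (g u) - z1" using f' u by (simp add: homeomorphism_def)
          also have "\<dots> = (g u - w) powi c * V (g u)" using V(3) u by (auto simp: T_def)
          also have "g u - w = (\<Prod>b\<leftarrow>as. u - b) * k u" using k(3) u by auto
          finally show ?thesis by (simp add: power_int_mult_distrib)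
        qed
        show "set as \<subseteq> G" using as by auto
      qed (rule z1S)
      with as show ?thesis unfolding G_def by blast
    qed
    obtain as where as: "set as = {u \<in> connected_component_set (- S) z1. g u = w}"
      and 1: "c * int (length as) = 1"
      using degree[OF z(1)] hole_of_inside(3)[OF z(1)] by (auto simp: w_def)
    obtain bs where bs: "set bs = {u \<in> connected_component_set (- S) z2. g u = w}"
      and 2: "c * int (length bs) = (if z1 \<in> connected_component_set (- S) z2 then 1 else 0)"
      using degree[OF z(2) z(3)[symmetric, folded w_def]] by blast
    \<comment> \<open>The hole of \<open>z1\<close> has no zero besides \<open>z1\<close>, so
      \<open>z2\<close> lies in another hole. There the count is 0 with \<open>c\<close> nonzero,
      leaving no room for \<open>z2\<close>.\<close>
    have "length as = 1" using 1 by (simp add: zmult_eq_1_iff)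
    have z2: "z2 \<in> set bs" using bs z hole_of_inside(3)[OF z(2)] by (simp add: w_def)
    have "z1 \<in> set as" using as hole_of_inside(3)[OF z(1)] by (simp add: w_def)
    with \<open>length as = 1\<close> ne have "z2 \<notin> set as" by (cases as) auto
    then have "z1 \<notin> connected_component_set (- S) z2"
      using as z by (auto simp: w_def dest: connected_component_sym)
    then have "c * int (length bs) = 0" using 2 by simp
    with 1 have "bs = []" by auto
    with z2 show False by simp
  qed
  have mixed: False if "z1 \<in> S" "z2 \<in> inside S" "g z1 = g z2" for z1 z2
  proof -
    have "g z1 \<in> inside (g ` S)" using that sub by auto
    then show False using that(1) inside_no_overlap[of "g ` S"] by blast
  qed
  show ?thesis
    by (rule inj_onI) (metis Un_iff inside mixed inj inj_onD)
qed

section \<open>Hulls, outer boundaries and their images\<close>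

text \<open>This lets results on \<open>S \<union> inside S\<close> be applied to the hull. The
  complement of the hull is connected and unbounded, so no hole of the frontier can leave the
  hull.\<close>

lemma outer_boundary_props:
  assumes K: "compact K"
  shows "compact (outer_boundary K)" "inside (outer_boundary K) = interior (poly_convex_hull K)"
    "outer_boundary K \<union> inside (outer_boundary K) = poly_convex_hull K"
proof -
  let ?H = "poly_convex_hull K"
  have H: "compact ?H" by (rule compact_poly_convex_hull[OF K])
  then show "compact (outer_boundary K)"
    by (simp add: outer_boundary_def compact_frontier)
  have "interior ?H \<subseteq> inside (frontier ?H)"
    by (rule interior_inside_frontier[OF compact_imp_bounded[OF H]])
  moreover have "inside (frontier ?H) \<subseteq> interior ?H"
  proof
    fix z assume z: "z \<in> inside (frontier ?H)"
    note G = hole_of_inside[OF z]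
    have frH: "frontier ?H \<subseteq> ?H" using H by (simp add: compact_imp_closed frontier_subset_closed)
    have "z \<in> ?H"
    proof (rule ccontr)
      assume "z \<notin> ?H"
      moreover have "connected (- ?H)"
        using K by (simp add: poly_convex_hull_eq connected_outside compact_imp_bounded)
      ultimately have "- ?H \<subseteq> connected_component_set (- frontier ?H) z"
        using frH by (intro connected_component_maximal) auto
      then have "bounded (- ?H)" using G(2) bounded_subset by blast
      then show False
        using K unbounded_outside[of K] by (simp add: poly_convex_hull_eq compact_imp_bounded)
    qed
    moreover have "z \<notin> frontier ?H" using z by (metis inside_no_overlap disjoint_iff)
    ultimately show "z \<in> interior ?H" by (auto simp: frontier_def closure_def)
  qed
  ultimately show eq: "inside (outer_boundary K) = interior ?H"
    by (auto simp: outer_boundary_def)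
  show "outer_boundary K \<union> inside (outer_boundary K) = ?H"
    unfolding eq using H interior_subset[of ?H]
    by (auto simp: outer_boundary_def frontier_def compact_imp_closed)
qed

lemma image_poly_convex_hull_subset:
  fixes g :: "complex \<Rightarrow> complex"
  assumes K: "compact K" and g: "continuous_on (poly_convex_hull K) g"
    "g holomorphic_on interior (poly_convex_hull K)" "inj_on g K"
  shows "g ` poly_convex_hull K \<subseteq> poly_convex_hull (g ` K)"
proof -
  let ?H = "poly_convex_hull K" and ?S = "outer_boundary K" and ?U = "outside (g ` K)"
  note S = outer_boundary_props[OF K]
  have SK: "?S \<subseteq> K" by (rule outer_boundary_subset[OF K])
  have "compact (g ` K)"
    by (intro compact_continuous_image K continuous_on_subset[OF g(1)] poly_convex_hull_superset)
  then have bd: "bounded (g ` K)" by (rule compact_imp_bounded)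
  have cpt: "compact (g ` ?H)"
    by (rule compact_continuous_image[OF g(1) compact_poly_convex_hull[OF K]])
  have op: "open (g ` inside ?S)"
  proof (rule open_image_inside)
    show "continuous_on (?S \<union> inside ?S) g" unfolding S(3) by (rule g)
    show "g holomorphic_on inside ?S" unfolding S(2) by (rule g)
    show "inj_on g ?S" using g(3) SK by (rule inj_on_subset)
  qed (simp add: S(1) compact_imp_closed)
  have disj: "?U \<inter> g ` ?S = {}" using SK outside_no_overlap[of "g ` K"] by blast
  \<comment> \<open>Boundary values lie in the image of \<open>K\<close>, so within
    \<open>?U\<close> only the open image of the inside is seen.\<close>
  have "?U \<inter> g ` ?H = ?U \<inter> g ` inside ?S"
    unfolding S(3)[symmetric] using disj by blast
  then have "openin (top_of_set ?U) (?U \<inter> g ` ?H)"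
    using op by (simp add: openin_open_Int)
  moreover have "closedin (top_of_set ?U) (?U \<inter> g ` ?H)"
    using cpt by (simp add: closedin_closed_Int compact_imp_closed)
  moreover have "connected ?U" using bd by (simp add: connected_outside)
  ultimately have "?U \<inter> g ` ?H = {} \<or> ?U \<inter> g ` ?H = ?U"
    by (auto simp: connected_clopen)
  moreover have "\<not> ?U \<subseteq> g ` ?H"
    using unbounded_outside[OF bd] cpt bounded_subset compact_imp_bounded by blast
  ultimately show ?thesis by (auto simp: poly_convex_hull_eq)
qed


lemma inj_on_poly_convex_hull_image:
  fixes g :: "complex \<Rightarrow> complex"
  assumes K: "compact K" and g: "continuous_on (poly_convex_hull K) g"
    "g holomorphic_on interior (poly_convex_hull K)" "inj_on g (poly_convex_hull K)"
  shows "g ` poly_convex_hull K = poly_convex_hull (g ` K)"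
    "g ` outer_boundary K = outer_boundary (g ` K)"
proof -
  let ?H = "poly_convex_hull K"
  note KH = poly_convex_hull_superset[of K]
  have H: "compact ?H" by (rule compact_poly_convex_hull[OF K])
  have C: "compact (g ` ?H)" by (rule compact_continuous_image[OF g(1) H])
  obtain g' where g': "homeomorphism ?H (g ` ?H) g g'"
    using homeomorphism_compact[OF H g(1) refl g(3)] by blast
  have "connected (- ?H)"
    using K by (simp add: poly_convex_hull_eq connected_outside compact_imp_bounded)
  \<comment> \<open>For compact plane sets, being Borsukian is equivalent to having connected
    complement, and it is a homeomorphism invariant.\<close>
  then have con: "connected (- (g ` ?H))"
    using g' Borsukian_separation_compact[OF H] Borsukian_separation_compact[OF C]
      homeomorphic_Borsukian homeomorphic_def by blast
  have unb: "\<not> bounded (- (g ` ?H))"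
    using C by (simp add: cobounded_imp_unbounded compact_imp_bounded)
  have "- (g ` ?H) \<subseteq> outside (g ` K)"
  proof
    fix y assume y: "y \<in> - (g ` ?H)"
    have "- (g ` ?H) \<subseteq> connected_component_set (- (g ` K)) y"
      using con y KH by (intro connected_component_maximal) auto
    then have "\<not> bounded (connected_component_set (- (g ` K)) y)"
      using unb bounded_subset by blast
    then show "y \<in> outside (g ` K)" using y KH by (auto simp: outside)
  qed
  moreover have "g ` ?H \<subseteq> poly_convex_hull (g ` K)"
    using g KH by (intro image_poly_convex_hull_subset K) (auto elim: inj_on_subset)
  ultimately show eq: "g ` ?H = poly_convex_hull (g ` K)"
    by (auto simp: poly_convex_hull_eq)
  \<comment> \<open>Invariance of domain is applied to \<open>g'\<close> and to \<open>g\<close>,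
    one for each inclusion between the two interiors.\<close>
  have g'int: "open (g' ` interior (g ` ?H))"
    using g' by (intro invariance_of_domain)
      (auto simp: homeomorphism_def inj_on_def interior_subset[THEN subsetD]
        intro: continuous_on_subset[OF _ interior_subset] dest!: interior_subset[THEN subsetD])
  have "g' ` interior (g ` ?H) \<subseteq> ?H"
    using g' interior_subset[of "g ` ?H"] by (auto simp: homeomorphism_def)
  with g'int have sub: "g' ` interior (g ` ?H) \<subseteq> interior ?H" by (rule interior_maximal[rotated])
  have "open (g ` interior ?H)"
    using g interior_subset[of ?H]
    by (intro invariance_of_domain) (auto elim: continuous_on_subset inj_on_subset)
  then have "g ` interior ?H \<subseteq> interior (g ` ?H)"
    using interior_subset[of ?H] by (intro interior_maximal) auto
  moreover have "interior (g ` ?H) \<subseteq> g ` interior ?H"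
  proof
    fix y assume y: "y \<in> interior (g ` ?H)"
    then have "g (g' y) = y" using g' interior_subset[of "g ` ?H"] by (auto simp: homeomorphism_def)
    moreover have "g' y \<in> interior ?H" using sub y by auto
    ultimately show "y \<in> g ` interior ?H" by (metis imageI)
  qed
  ultimately have int: "interior (g ` ?H) = g ` interior ?H" by auto
  have "outer_boundary (g ` K) = g ` ?H - g ` interior ?H"
    unfolding outer_boundary_def eq[symmetric] frontier_def int[symmetric]
    using C by (simp add: compact_imp_closed)
  also have "\<dots> = g ` (?H - interior ?H)"
    by (rule inj_on_image_set_diff[symmetric, OF g(3)]) (auto simp: interior_subset)
  also have "?H - interior ?H = outer_boundary K"
    using H by (simp add: outer_boundary_def frontier_def compact_imp_closed)
  finally show "g ` outer_boundary K = outer_boundary (g ` K)" ..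
qed

lemma holes_subset_inside: "G \<in> holes S \<Longrightarrow> G \<subseteq> inside S"
  using poly_convex_hull_eq[of S] in_components_subset
  by (fastforce simp: holes_def poly_convex_hull_def union_with_inside[symmetric])

text \<open>Holes are maximal connected subsets of the complement. Since \<open>g\<close> matches
  the insides, \<open>g\<close> and its inverse carry connected sets avoiding one boundary to
  connected sets avoiding the other, which gives both inclusions.\<close>

lemma hole_image_unique:
  fixes g :: "complex \<Rightarrow> complex"
  assumes S: "compact (S \<union> inside S)" and g: "continuous_on (S \<union> inside S) g" "inj_on g (S \<union> inside S)"
    and ins: "g ` inside S = inside (g ` S)" and H: "H \<in> holes (g ` S)"
  shows "\<exists>!G. G \<in> holes S \<and> g ` G = H"
proof (rule ex_ex1I)
  obtain g' where g': "homeomorphism (S \<union> inside S) (g ` (S \<union> inside S)) g g'"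
    using homeomorphism_compact[OF S g(1) refl g(2)] by blast
  have Hc: "H \<in> components (- (g ` S))" using H by (simp add: holes_def)
  have Hi: "H \<subseteq> g ` inside S" using holes_subset_inside[OF H] ins by simp
  obtain z where z: "z \<in> inside S" "g z \<in> H"
    using Hi in_components_nonempty[OF Hc] by blast
  define G where "G = connected_component_set (- S) z"
  note G = hole_of_inside[OF z(1), folded G_def]
  have "connected (g ` G)"
    using G(4) by (intro connected_continuous_image continuous_on_subset[OF g(1)]) (auto simp: G_def)
  moreover have "g ` G \<subseteq> - (g ` S)"
    using G(4) ins inside_no_overlap[of "g ` S"] by blast
  ultimately have "g ` G \<subseteq> H"
    using z G(3) by (intro components_maximal[OF Hc]) auto
  moreover have "H \<subseteq> g ` G"
  proof -
    have "continuous_on H g'"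
      using g' Hi by (auto simp: homeomorphism_def intro: continuous_on_subset[where s = "g ` (S \<union> inside S)"])
    then have "connected (g' ` H)"
      using in_components_connected[OF Hc] by (rule connected_continuous_image)
    moreover have sub: "g' ` H \<subseteq> inside S" using Hi g' by (auto simp: homeomorphism_def)
    moreover have "z \<in> g' ` H" using z g' by (force simp: homeomorphism_def)
    ultimately have "g' ` H \<subseteq> G"
      unfolding G_def using inside_no_overlap[of S] by (intro connected_component_maximal) blast+
    moreover have "g (g' y) = y" if "y \<in> H" for y using g' Hi that by (auto simp: homeomorphism_def)
    ultimately show ?thesis by (metis image_eqI image_subset_iff subsetI)
  qed
  ultimately show "\<exists>G. G \<in> holes S \<and> g ` G = H"
    using G by (auto simp: holes_def)
next
  fix G1 G2 assume "G1 \<in> holes S \<and> g ` G1 = H" "G2 \<in> holes S \<and> g ` G2 = H"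
  then show "G1 = G2"
    using inj_on_image_eq_iff[OF g(2), of G1 G2] holes_subset_inside by blast
qed

section \<open>The equivalence for the Gelfand transform\<close>

theorem theorem2p7:
  fixes K :: "complex set" and f :: "complex \<Rightarrow> complex"
  assumes "compact K" and "f \<in> poly_closure K" and "inj_on f K"
  shows "(inj_on (gelfand_transform K f) (poly_convex_hull K) \<longleftrightarrow>
            f ` outer_boundary K = outer_boundary (f ` K))
       \<and> (inj_on (gelfand_transform K f) (poly_convex_hull K) \<longrightarrow>
            gelfand_transform K f ` poly_convex_hull K = poly_convex_hull (f ` K) \<and>
            (\<forall>H \<in> holes (f ` outer_boundary K).
               \<exists>!G. G \<in> holes (outer_boundary K) \<and> gelfand_transform K f ` G = H))"
proof -
  define g where "g = gelfand_transform K f"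
  let ?S = "outer_boundary K"
  have K: "compact K" by fact
  note S = outer_boundary_props[OF K]
  have SK: "?S \<subseteq> K" by (rule outer_boundary_subset[OF K])
  have g: "continuous_on (poly_convex_hull K) g" "g holomorphic_on interior (poly_convex_hull K)"
    and gf: "\<And>z. z \<in> K \<Longrightarrow> g z = f z"
    using gelfand_transform_props[OF K assms(2)] by (auto simp: g_def is_gelfand_transform_def)
  have gK: "g ` K = f ` K" and gS: "g ` ?S = f ` ?S"
    using gf SK by (auto simp: image_iff subset_iff)
  have injK: "inj_on g K" using assms(3) gf by (simp cong: inj_on_cong)
  have cfK: "compact (f ` K)"
    unfolding gK[symmetric]
    by (intro compact_continuous_image K continuous_on_subset[OF g(1)] poly_convex_hull_superset)
  note T = outer_boundary_props[OF cfK]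
  have fwd: "g ` poly_convex_hull K = poly_convex_hull (f ` K)" "f ` ?S = outer_boundary (f ` K)"
    if "inj_on g (poly_convex_hull K)"
    using inj_on_poly_convex_hull_image[OF K g that] gK gS by auto
  have bwd: "inj_on g (poly_convex_hull K)" if eq: "f ` ?S = outer_boundary (f ` K)"
  proof -
    have contS: "continuous_on (?S \<union> inside ?S) g" unfolding S(3) by (rule g)
    have holS: "g holomorphic_on inside ?S" unfolding S(2) by (rule g)
    have injS: "inj_on g ?S" using injK SK by (rule inj_on_subset)
    have "open (g ` inside ?S)"
      by (rule open_image_inside[OF _ contS holS injS]) (simp add: S(1) compact_imp_closed)
    moreover have "g ` inside ?S \<subseteq> poly_convex_hull (f ` K)"
      using image_poly_convex_hull_subset[OF K g injK] S(3) gK by auto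
    ultimately have "g ` inside ?S \<subseteq> interior (poly_convex_hull (f ` K))"
      by (rule interior_maximal[rotated])
    \<comment> \<open>Here the hypothesis on outer boundaries enters: it identifies the image of
      \<open>?S\<close> with the frontier of the hull of the image of \<open>K\<close>.\<close>
    also have "\<dots> = inside (g ` ?S)" using eq gS T(2) by simp
    finally have "inj_on g (?S \<union> inside ?S)"
      by (rule inj_on_inside[OF S(1) contS holS injS])
    then show ?thesis unfolding S(3) .
  qed
  have holes: "\<exists>!G. G \<in> holes ?S \<and> g ` G = H"
    if inj: "inj_on g (poly_convex_hull K)" and H: "H \<in> holes (f ` ?S)" for H
  proof (rule hole_image_unique)
    have "?S \<inter> inside ?S = {}" using inside_no_overlap by blast
    \<comment> \<open>Insides are written as hull minus outer boundary, a difference that the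
      injective \<open>g\<close> preserves.\<close>
    then have "inside ?S = poly_convex_hull K - ?S" using S(3) by blast
    then have "g ` inside ?S = g ` poly_convex_hull K - g ` ?S"
      using S(3) inj_on_image_set_diff[OF inj, of "poly_convex_hull K" ?S] by auto
    also have "\<dots> = poly_convex_hull (f ` K) - outer_boundary (f ` K)"
      using fwd[OF inj] gS by simp
    also have "\<dots> = inside (g ` ?S)"
      unfolding gS fwd(2)[OF inj] using T(3) inside_no_overlap[of "outer_boundary (f ` K)"] by blast
    finally show "g ` inside ?S = inside (g ` ?S)" .
  qed (use g inj H gS compact_poly_convex_hull[OF K] in \<open>simp_all add: S(3)\<close>)
  show ?thesis
    unfolding g_def[symmetric]
    by (intro conjI impI iffI ballI) (assumption | rule fwd bwd holes)+
qed

end
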